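(* Let $G$ be a $2$-connected nontrivial uniquely $C_9$-saturated graph, let $C$ be a longest even cycle among the even cycles of $G$ of length at most $12$, and suppose that $C$ has length $6$. Let $R=V(G)\setminus V(C)$. Then every vertex of $R$ has a neighbour on $C$.
   Context: All graphs are finite and simple. A graph $G$ is uniquely $C_9$-saturated if it contains no cycle of length $9$ and, for every edge $e$ of the complement $\overline{G}$, $G+e$ contains exactly one cycle of length $9$; it is nontrivial if $|V(G)|\ge 9$. *)

theory Defs
  imports "Graph_Theory.Graph_Theory"
begin

text \<open>
  A finite simple graph is a \<open>pair_graph\<close>, that is, a finite symmetric loop-free digraph without
  parallel arcs: an edge \<open>uv\<close> is the pair of arcs \<open>(u, v)\<close>, \<open>(v, u)\<close>.
\<close>

text \<open>
  An undirected cycle is a subgraph, so the rotations and the reversal of one closed walk \<open>p\<close> give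
  the same cycle. The bound \<open>3 \<le> k\<close> is needed because \<open>pre_digraph.cycle\<close> also admits
  \<open>[(u, v), (v, u)]\<close>.
\<close>

definition cycles_of :: "'a pair_pre_digraph \<Rightarrow> nat \<Rightarrow> 'a pair_pre_digraph set" where
  "cycles_of G k =
     {C. 3 \<le> k \<and>
         (\<exists>p. pre_digraph.cycle (with_proj G) p \<and> length p = k \<and>
              C = \<lparr> pverts = fst ` set p, parcs = set p \<union> (set p)\<inverse> \<rparr>)}"

definition add_edge :: "'a pair_pre_digraph \<Rightarrow> 'a \<Rightarrow> 'a \<Rightarrow> 'a pair_pre_digraph" where
  "add_edge G u v = \<lparr> pverts = pverts G, parcs = parcs G \<union> {(u, v), (v, u)} \<rparr>"

definition uniquely_cycle_saturated :: "nat \<Rightarrow> 'a pair_pre_digraph \<Rightarrow> bool" where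
  "uniquely_cycle_saturated k G \<longleftrightarrow>
     cycles_of G k = {} \<and>
     (\<forall>u \<in> pverts G. \<forall>v \<in> pverts G. u \<noteq> v \<longrightarrow> (u, v) \<notin> parcs G \<longrightarrow>
        (\<exists>!C. C \<in> cycles_of (add_edge G u v) k))"

definition k_connected :: "nat \<Rightarrow> 'a pair_pre_digraph \<Rightarrow> bool" where
  "k_connected k G \<longleftrightarrow>
     k < card (pverts G) \<and>
     (\<forall>X \<subseteq> pverts G. card X < k \<longrightarrow> connected (with_proj G \<restriction> (pverts G - X)))"

definition longest_even_cycle_upto ::
    "nat \<Rightarrow> 'a pair_pre_digraph \<Rightarrow> nat \<Rightarrow> 'a pair_pre_digraph \<Rightarrow> bool" where
  "longest_even_cycle_upto m G k C \<longleftrightarrow>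
     C \<in> cycles_of G k \<and> even k \<and> k \<le> m \<and>
     (\<forall>k' C'. C' \<in> cycles_of G k' \<longrightarrow> even k' \<longrightarrow> k' \<le> m \<longrightarrow> k' \<le> k)"

end

theory Submission
  imports Defs
begin

text \<open>
  The hypotheses are contradictory: they force the graph to be complete, and then nine of its
  vertices form a cycle of length 9. So the claim holds vacuously.

  The argument rests on the following facts. There are no cycles of length 8, 9, 10 or 12. Two
  nonadjacent vertices are the ends of exactly one path with eight edges, and adjacent vertices are
  the ends of none. No single vertex disconnects the graph.

  Suppose \<open>x\<close> and \<open>z\<close> are not adjacent but have a common neighbour \<open>m\<close>. The path with eight
  edges between them must pass through \<open>m\<close>, so together with the edges \<open>xm\<close> and \<open>mz\<close> it forms
  a bowtie: two cycles that share exactly \<open>m\<close> and have nine vertices in total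
  (\<open>bowtie_exists\<close>). Any path that connects the two cycles outside \<open>m\<close> closes four cycles with
  their arcs, and long ones produce pairs of paths with eight edges. This excludes all connections
  except single edges (\<open>no_long_connection\<close>, \<open>crossing_edge\<close>). It follows that opposite vertices
  of a cycle of length 4 are adjacent (\<open>square_diagonal\<close>), that the two cycles have lengths 3 and 7
  or 5 and 5, and that the connecting edge has one position up to symmetry (\<open>crossing_types\<close>).

  Such an edge does exist, as \<open>m\<close> does not separate the graph. The nine vertices then contain
  another nonadjacent pair with a common neighbour, and the second bowtie that this pair creates
  cannot be reconciled with the paths present in the first one
  (\<open>no_triangle_heptagon_bowtie\<close>, \<open>no_pentagon_bowtie\<close>). Hence there are no bowties
  (\<open>no_bowtie\<close>): vertices with a common neighbour are adjacent, and by connectedness all vertices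
  are.
\<close>

section \<open>Paths and cycles as vertex lists\<close>

definition gpath :: "('a \<Rightarrow> 'a \<Rightarrow> bool) \<Rightarrow> 'a list \<Rightarrow> bool" where
  "gpath E xs \<longleftrightarrow> distinct xs \<and> successively E xs"

definition gcycle :: "('a \<Rightarrow> 'a \<Rightarrow> bool) \<Rightarrow> 'a list \<Rightarrow> bool" where
  "gcycle E xs \<longleftrightarrow> gpath E xs \<and> xs \<noteq> [] \<and> E (last xs) (hd xs)"

text \<open>
  On a list that starts in one set and ends in a disjoint one, consider the first entry \<open>q\<close> in the
  second set and the last entry \<open>p\<close> of the first set before it: nothing strictly between them lies
  in either set.
\<close>

lemma split_at_crossing:
  assumes "xs \<noteq> []" "hd xs \<in> S" "last xs \<in> T" "S \<inter> T = {}"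
  obtains ys p rs q zs where "xs = ys @ p # rs @ q # zs" "p \<in> S" "q \<in> T"
    "set rs \<inter> (S \<union> T) = {}"
proof -
  have "\<exists>q \<in> set xs. q \<in> T" using assms by auto
  from split_list_first_prop[OF this] obtain us q zs where
    xs: "xs = us @ q # zs" and q: "q \<in> T" and us: "\<forall>y \<in> set us. y \<notin> T" by blast
  have "us \<noteq> []" using xs assms q by auto
  then have "\<exists>p \<in> set us. p \<in> S" using xs assms by (metis hd_append2 list.set_sel(1))
  from split_list_last_prop[OF this] obtain ys p rs where
    "us = ys @ p # rs" "p \<in> S" "\<forall>y \<in> set rs. y \<notin> S" by blast
  with xs q us show ?thesis by (intro that[of ys p rs q zs]) auto
qed

lemma le_5_cases: "n \<le> 5 \<longleftrightarrow> n = 0 \<or> n = 1 \<or> n = 2 \<or> n = 3 \<or> n = 4 \<or> n = 5" for n :: nat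
  by (simp add: le_Suc_eq numeral_eq_Suc)

text \<open>
  The arithmetic behind the connections between the two cycles of a bowtie, defined below. A vertex
  of a cycle splits the other vertices of its lobe into \<open>i\<close> and \<open>i'\<close>, respectively \<open>j\<close> and
  \<open>j'\<close>, and a connection with \<open>r\<close> inner vertices closes four cycles, one for each choice of arcs.
  If none of them has a forbidden length, then few configurations survive.
\<close>

lemma connection_arith:
  fixes i i' j j' r :: nat
  assumes lens: "i + j + r + 3 \<notin> {8, 9, 10, 12}" "i' + j + r + 3 \<notin> {8, 9, 10, 12}"
    "i + j' + r + 3 \<notin> {8, 9, 10, 12}" "i' + j' + r + 3 \<notin> {8, 9, 10, 12}"
    and s: "i + i' + j + j' = 6" "1 \<le> i + i'" "1 \<le> j + j'"
  shows "i + i' \<le> j + j' \<Longrightarrow> r = 1 \<or> r = 2 \<Longrightarrow> r = 1 \<and> i = 1 \<and> i' = 1 \<and> j = 2 \<and> j' = 2"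
    and "r = 0 \<Longrightarrow> i + i' \<noteq> 2 \<Longrightarrow> j + j' \<noteq> 2 \<Longrightarrow>
      (i + i' = 1 \<and> j + j' = 5 \<and> (j = 2 \<or> j = 3)) \<or>
      (i + i' = 5 \<and> j + j' = 1 \<and> (i = 2 \<or> i = 3)) \<or>
      (i + i' = 3 \<and> j + j' = 3 \<and> (i = 1 \<or> i = 2) \<and> (j = 1 \<or> j = 2))"
proof -
  have le: "i \<le> 5" "i' \<le> 5" "j \<le> 5" and j': "j' = 6 - (i + i' + j)" using s by linarith+
  show "i + i' \<le> j + j' \<Longrightarrow> r = 1 \<or> r = 2 \<Longrightarrow> r = 1 \<and> i = 1 \<and> i' = 1 \<and> j = 2 \<and> j' = 2"
    using lens s le unfolding le_5_cases j' by (elim disjE, simp_all only:, simp_all)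
  show "r = 0 \<Longrightarrow> i + i' \<noteq> 2 \<Longrightarrow> j + j' \<noteq> 2 \<Longrightarrow>
      (i + i' = 1 \<and> j + j' = 5 \<and> (j = 2 \<or> j = 3)) \<or>
      (i + i' = 5 \<and> j + j' = 1 \<and> (i = 2 \<or> i = 3)) \<or>
      (i + i' = 3 \<and> j + j' = 3 \<and> (i = 1 \<or> i = 2) \<and> (j = 1 \<or> j = 2))"
    using lens s le unfolding le_5_cases j' by (elim disjE, simp_all only:, simp_all)
qed

section \<open>Bowties\<close>

text \<open>
  The adjacency relation of the graph, reduced to what the argument uses. Lengths count vertices, so
  \<open>path9_exists\<close> and \<open>path9_unique\<close> speak of paths with eight edges: adding an edge between the two
  ends of such a path creates a cycle of length 9. Uniqueness also holds for adjacent ends, where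
  there is no such path at all.
\<close>

locale cycle9_saturated =
  fixes V :: "'a set" and E :: "'a \<Rightarrow> 'a \<Rightarrow> bool"
  assumes finite_V: "finite V" and card_V: "9 \<le> card V"
    and in_V: "E x y \<Longrightarrow> x \<in> V"
    and sym: "E x y \<Longrightarrow> E y x"
    and irrefl: "\<not> E x x"
    and no_cycle: "gcycle E xs \<Longrightarrow> length xs \<notin> {8, 9, 10, 12}"
    and path9_exists: "x \<in> V \<Longrightarrow> y \<in> V \<Longrightarrow> x \<noteq> y \<Longrightarrow> \<not> E x y \<Longrightarrow>
      \<exists>xs. gpath E xs \<and> length xs = 9 \<and> hd xs = x \<and> last xs = y"
    and path9_unique: "gpath E xs \<Longrightarrow> gpath E ys \<Longrightarrow> length xs = 9 \<Longrightarrow> length ys = 9 \<Longrightarrow>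
      hd xs = hd ys \<Longrightarrow> last xs = last ys \<Longrightarrow> xs = ys"
    and connected_minus: "x \<in> V \<Longrightarrow> y \<in> V \<Longrightarrow> x \<noteq> m \<Longrightarrow> y \<noteq> m \<Longrightarrow>
      \<exists>xs. gpath E xs \<and> xs \<noteq> [] \<and> m \<notin> set xs \<and> hd xs = x \<and> last xs = y"
begin

lemma E_commute: "E x y \<longleftrightarrow> E y x"
  using sym by blast

lemma successively_flip [simp]: "successively (\<lambda>x y. E y x) xs \<longleftrightarrow> successively E xs"
proof -
  have "(\<lambda>x y. E y x) = E" using E_commute by blast
  then show ?thesis by (rule arg_cong)
qed

text \<open>
  Walks are built piece by piece by gluing at a common vertex.
\<close>

lemma successively_join: "successively E (xs @ p # ys) \<longleftrightarrow> successively E (xs @ [p]) \<and> successively E (p # ys)"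
  by (auto simp: successively_append_iff)

text \<open>
  Two cycles \<open>m # as\<close> and \<open>m # bs\<close> that share only the vertex \<open>m\<close>, with nine vertices
  altogether. The lists \<open>as\<close> and \<open>bs\<close> are called the lobes.
\<close>

definition bowtie :: "'a \<Rightarrow> 'a list \<Rightarrow> 'a list \<Rightarrow> bool" where
  "bowtie m as bs \<longleftrightarrow> distinct (m # as @ bs) \<and> successively E as \<and> successively E bs \<and>
     E m (hd as) \<and> E m (last as) \<and> E m (hd bs) \<and> E m (last bs) \<and>
     2 \<le> length as \<and> 2 \<le> length bs \<and> length as + length bs = 8"

lemma bowtie_swap: "bowtie m as bs \<Longrightarrow> bowtie m bs as"
  unfolding bowtie_def by auto

lemma bowtie_rev_left: "bowtie m as bs \<Longrightarrow> bowtie m (rev as) bs"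
  unfolding bowtie_def by (auto simp: hd_rev last_rev)

lemma bowtie_rev_right: "bowtie m as bs \<Longrightarrow> bowtie m as (rev bs)"
  unfolding bowtie_def by (auto simp: hd_rev last_rev)

text \<open>
  This is where saturation enters. The ends \<open>x\<close> and \<open>z\<close> are joined by a path with eight edges. It
  must pass through the common neighbour \<open>m\<close>, as otherwise \<open>m\<close> closes it to a cycle of length 10,
  and it must not visit \<open>m\<close> directly next to an end, as otherwise dropping that end leaves a cycle
  of length 8. So \<open>m\<close> cuts the path into two pieces, which the edges \<open>xm\<close> and \<open>mz\<close> close to
  the two cycles of a bowtie.
\<close>

lemma bowtie_exists:
  assumes "E x m" "E m z" "x \<noteq> z" "\<not> E x z"
  obtains as bs where "bowtie m as bs" "hd as = x" "hd bs = z"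
proof -
  have "x \<in> V" "z \<in> V" using assms in_V sym by blast+
  then obtain xs where xs: "gpath E xs" "length xs = 9" "hd xs = x" "last xs = z"
    using path9_exists assms by blast
  have ne: "x \<noteq> m" "z \<noteq> m" using assms irrefl by auto
  have "m \<in> set xs"
  proof (rule ccontr)
    assume "m \<notin> set xs"
    then have "gcycle E (m # xs)" using xs assms sym[OF assms(1)] sym[OF assms(2)]
      by (auto simp: gcycle_def gpath_def successively_Cons)
    then show False using no_cycle xs(2) by fastforce
  qed
  then obtain as cs where s: "xs = as @ m # cs" by (meson split_list)
  have ne2: "as \<noteq> []" "cs \<noteq> []" using s xs ne by auto
  have hl: "hd as = x" "last cs = z" using s xs ne2 by auto
  have d: "distinct (as @ m # cs)" "successively E as" "successively E cs" "E (last as) m" "E m (hd cs)"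
    using xs(1) s ne2 by (auto simp: gpath_def successively_append_iff successively_Cons)
  have "length as \<noteq> 1"
  proof
    assume "length as = 1"
    then have "length (m # cs) = 8" using s xs by auto
    moreover have "gcycle E (m # cs)" using d hl assms sym ne2
      by (auto simp: gcycle_def gpath_def successively_Cons)
    ultimately show False using no_cycle by fastforce
  qed
  moreover have "length cs \<noteq> 1"
  proof
    assume "length cs = 1"
    then have "length (as @ [m]) = 8" using s xs by auto
    moreover have "gcycle E (as @ [m])" using d hl assms sym ne2
      by (auto simp: gcycle_def gpath_def successively_append_iff)
    ultimately show False using no_cycle by fastforce
  qed
  ultimately have "bowtie m as (rev cs)"
    using d hl assms ne2 sym s xs(2)
    by (cases as; cases cs) (auto simp: bowtie_def hd_rev last_rev Suc_le_eq simp del: rev.simps)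
  then show ?thesis using that hl ne2 by (simp add: hd_rev)
qed

lemma bowtie_arcs_left:
  assumes "bowtie m (as1 @ p # as2) bs"
  shows "successively E (m # as1 @ [p])" "successively E (p # as2 @ [m])"
    "successively E (m # rev as2 @ [p])" "successively E (p # rev as1 @ [m])"
proof -
  show *: "successively E (m # as1 @ [p])" "successively E (p # as2 @ [m])"
    using assms sym by (auto simp: bowtie_def successively_append_iff successively_Cons hd_append split: if_splits)
  show "successively E (m # rev as2 @ [p])"
    using *(2) successively_flip[of "p # as2 @ [m]"] successively_rev[of E "p # as2 @ [m]"] by simp
  show "successively E (p # rev as1 @ [m])"
    using *(1) successively_flip[of "m # as1 @ [p]"] successively_rev[of E "m # as1 @ [p]"] by simp
qed

lemmas bowtie_arcs_right = bowtie_arcs_left[OF bowtie_swap]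

section \<open>Connections between the lobes of a bowtie\<close>

text \<open>
  A path \<open>p # rs @ [q]\<close> from one lobe to the other that avoids the bowtie in between closes a
  cycle with one arc from \<open>m\<close> to \<open>p\<close> and one from \<open>q\<close> to \<open>m\<close>.
\<close>

lemma connection_cycle:
  assumes b: "bowtie m (as1 @ p # as2) (bs1 @ q # bs2)"
    and path: "gpath E (p # rs @ [q])"
    and dis: "set rs \<inter> (insert m (set (as1 @ p # as2) \<union> set (bs1 @ q # bs2))) = {}"
  shows "length as1 + length bs1 + length rs + 3 \<notin> {8, 9, 10, 12}"
proof -
  have "successively E ((m # as1) @ p # rs @ [q])"
    using bowtie_arcs_left(1)[OF b] path by (subst successively_join) (simp add: gpath_def)
  then have "successively E ((m # as1 @ p # rs) @ q # rev bs1 @ [m])"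
    using bowtie_arcs_right(4)[OF b] by (subst successively_join) simp
  then have "successively E ((m # as1 @ p # rs @ q # rev bs1) @ [m])" by simp
  then have "gcycle E (m # as1 @ p # rs @ q # rev bs1)"
    using b path dis unfolding successively_append_iff
    by (auto simp: gcycle_def gpath_def bowtie_def)
  from no_cycle[OF this] show ?thesis by simp
qed

text \<open>
  The four choices of arcs are related by reversing the lobes.
\<close>

lemma connection_lengths:
  assumes b: "bowtie m (as1 @ p # as2) (bs1 @ q # bs2)"
    and path: "gpath E (p # rs @ [q])"
    and dis: "set rs \<inter> (insert m (set (as1 @ p # as2) \<union> set (bs1 @ q # bs2))) = {}"
  shows "length as1 + length bs1 + length rs + 3 \<notin> {8, 9, 10, 12}"
    "length as2 + length bs1 + length rs + 3 \<notin> {8, 9, 10, 12}"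
    "length as1 + length bs2 + length rs + 3 \<notin> {8, 9, 10, 12}"
    "length as2 + length bs2 + length rs + 3 \<notin> {8, 9, 10, 12}"
    "length as1 + length as2 + length bs1 + length bs2 = 6"
    "length as1 + length as2 \<ge> 1" "length bs1 + length bs2 \<ge> 1"
proof -
  show "length as1 + length bs1 + length rs + 3 \<notin> {8, 9, 10, 12}"
    using connection_cycle[OF assms] .
  have "bowtie m (rev as2 @ p # rev as1) (bs1 @ q # bs2)" using bowtie_rev_left[OF b] by simp
  from connection_cycle[OF this path] show "length as2 + length bs1 + length rs + 3 \<notin> {8, 9, 10, 12}"
    using dis by auto
  have "bowtie m (as1 @ p # as2) (rev bs2 @ q # rev bs1)" using bowtie_rev_right[OF b] by simp
  from connection_cycle[OF this path] show "length as1 + length bs2 + length rs + 3 \<notin> {8, 9, 10, 12}"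
    using dis by auto
  have "bowtie m (rev as2 @ p # rev as1) (rev bs2 @ q # rev bs1)"
    using bowtie_rev_left[OF bowtie_rev_right[OF b]] by simp
  from connection_cycle[OF this path] show "length as2 + length bs2 + length rs + 3 \<notin> {8, 9, 10, 12}"
    using dis by auto
  show "length as1 + length as2 + length bs1 + length bs2 = 6"
    "length as1 + length as2 \<ge> 1" "length bs1 + length bs2 \<ge> 1"
    using b by (auto simp: bowtie_def)
qed

text \<open>
  A connection has no inner vertices. With one or two of them the forbidden cycle lengths leave a
  single case. With three or more, let \<open>w\<close> be the third. In a bowtie there is a vertex \<open>y\<close> on
  the lobe \<open>bs\<close> opposite to \<open>p\<close>: going from \<open>p\<close> to \<open>y\<close> around either side of the figure
  eight takes five edges, since the figure eight is a closed walk with ten edges. Together with the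
  three edges from \<open>w\<close> to \<open>p\<close> this gives two paths with eight edges from \<open>w\<close> to \<open>y\<close>,
  against uniqueness. That \<open>bs\<close> is the longer lobe guarantees that \<open>y\<close> lies on it.
\<close>

lemma no_long_connection_le:
  assumes b: "bowtie m (as1 @ p # as2) (bs1 @ q # bs2)"
    and path: "gpath E (p # rs @ [q])"
    and dis: "set rs \<inter> (insert m (set (as1 @ p # as2) \<union> set (bs1 @ q # bs2))) = {}"
    and le: "length (as1 @ p # as2) \<le> length (bs1 @ q # bs2)"
  shows "rs = []"
proof (rule ccontr)
  assume "rs \<noteq> []"
  note len = connection_lengths[OF b path dis]
  define bs where "bs = bs1 @ q # bs2"
  show False
  proof (cases "3 \<le> length rs")
    case True
    then obtain r1 r2 w rs' where rs: "rs = r1 # r2 # w # rs'"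
      by (metis (no_types, opaque_lifting) One_nat_def Suc_le_length_iff numeral_3_eq_3)
    \<comment> \<open>the first arc uses \<open>length as1 + 1\<close> edges up to \<open>m\<close>; \<open>k + 1\<close> more edges make five\<close>
    define k where "k = 3 - length as1"
    have k: "k < length bs" "length as1 + k = 3" "4 \<le> length bs"
      using len(5-7) le by (auto simp: bs_def k_def)
    define y cs1 cs2 where "y = bs ! k" and "cs1 = take k bs" and "cs2 = drop (Suc k) bs"
    have bs': "bs1 @ q # bs2 = cs1 @ y # cs2" "length cs1 = k"
      using k(1) id_take_nth_drop[OF k(1)] by (simp_all add: bs_def[symmetric] y_def cs1_def cs2_def)
    have "length (bs1 @ q # bs2) = length (cs1 @ y # cs2)" unfolding bs' ..
    then have k2: "length as2 + length cs2 = 3" using len(5) k(2) bs'(2) by auto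
    have b': "bowtie m (as1 @ p # as2) (cs1 @ y # cs2)" using b bs' by simp
    have "successively E (p # r1 # r2 # [w])" using path rs
      by (simp add: gpath_def successively_Cons)
    then have start: "successively E ([w, r2, r1] @ [p])" using sym by auto
    \<comment> \<open>both paths leave \<open>w\<close> for \<open>p\<close> and meet again only in \<open>m\<close> and in \<open>y\<close>\<close>
    have walk: "successively E ([w, r2, r1] @ p # xs @ m # ys @ [y])"
      if "successively E (p # xs @ [m])" "successively E (m # ys @ [y])" for xs ys
    proof -
      have "successively E ((p # xs) @ m # ys @ [y])" using that by (subst successively_join) simp
      then show ?thesis using start by (subst successively_join) simp
    qed
    have d: "distinct (m # as1 @ p # as2 @ cs1 @ y # cs2)" using b' by (auto simp: bowtie_def)
    have r: "distinct [w, r2, r1]" "set [w, r2, r1] \<inter> set (m # as1 @ p # as2 @ cs1 @ y # cs2) = {}"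
      using dis path unfolding rs bs' gpath_def by auto
    let ?P = "[w, r2, r1] @ p # rev as1 @ m # cs1 @ [y]"
    let ?Q = "[w, r2, r1] @ p # as2 @ m # rev cs2 @ [y]"
    have "gpath E ?P" using d r walk[OF bowtie_arcs_left(4)[OF b'] bowtie_arcs_right(1)[OF b']]
      by (auto simp: gpath_def)
    moreover have "gpath E ?Q" using d r walk[OF bowtie_arcs_left(2)[OF b'] bowtie_arcs_right(3)[OF b']]
      by (auto simp: gpath_def)
    moreover have "length ?P = 9" "length ?Q = 9" using k k2 bs'(2) by auto
    ultimately have eq: "?P = ?Q" by (intro path9_unique) auto
    \<comment> \<open>the two arcs from \<open>m\<close> to \<open>y\<close> are disjoint, so equal paths would leave only \<open>y\<close> on this lobe\<close>
    have "set cs1 \<subseteq> set ?Q" unfolding eq[symmetric] by auto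
    then have "cs1 = []" using d r by (cases cs1) auto
    moreover have "set cs2 \<subseteq> set ?P" unfolding eq by auto
    then have "cs2 = []" using d r by (cases cs2) auto
    ultimately have "length bs = 1" using bs' by (simp add: bs_def)
    then show False using k by simp
  next
    case False
    with \<open>rs \<noteq> []\<close> have "length rs = 1 \<or> length rs = 2"
      by (cases rs) (auto simp: not_le less_Suc_eq numeral_2_eq_2 numeral_3_eq_3)
    moreover have "length as1 + length as2 \<le> length bs1 + length bs2" using le by simp
    \<comment> \<open>the surviving case: \<open>p\<close> is opposite to \<open>m\<close> in a cycle of length 4, so that
      its two arcs have equal length and extend to two paths along all of the other lobe\<close>
    ultimately have *: "length rs = 1" "length as1 = 1" "length as2 = 1" "length bs = 5"
      using connection_arith(1)[OF len] unfolding bs_def by auto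
    obtain w where w: "rs = [w]" using *(1) by (auto simp: length_Suc_conv)
    have start: "successively E ([w] @ [p])" using path sym by (auto simp: w gpath_def)
    have end_: "successively E (m # bs)" using b by (auto simp: bowtie_def bs_def successively_Cons)
    have walk: "successively E ([w] @ p # xs @ m # bs)" if "successively E (p # xs @ [m])" for xs
    proof -
      have "successively E ((p # xs) @ m # bs)" using that end_ by (subst successively_join) simp
      then show ?thesis using start by (subst successively_join) simp
    qed
    have d: "distinct (m # as1 @ p # as2 @ bs)" using b by (auto simp: bowtie_def bs_def)
    have "gpath E ([w] @ p # rev as1 @ m # bs)"
      using walk[OF bowtie_arcs_left(4)[OF b]] d dis by (auto simp: gpath_def w bs_def)
    moreover have "gpath E ([w] @ p # as2 @ m # bs)"
      using walk[OF bowtie_arcs_left(2)[OF b]] d dis by (auto simp: gpath_def w bs_def)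
    ultimately have "[w] @ p # rev as1 @ m # bs = [w] @ p # as2 @ m # bs"
      using * by (intro path9_unique) auto
    then have "rev as1 = as2" by simp
    then show False using * d by (auto simp: length_Suc_conv)
  qed
qed


lemma no_long_connection:
  assumes b: "bowtie m (as1 @ p # as2) (bs1 @ q # bs2)"
    and path: "gpath E (p # rs @ [q])"
    and dis: "set rs \<inter> (insert m (set (as1 @ p # as2) \<union> set (bs1 @ q # bs2))) = {}"
  shows "rs = []"
proof (cases "length (as1 @ p # as2) \<le> length (bs1 @ q # bs2)")
  case True
  then show ?thesis using no_long_connection_le assms by blast
next
  case False
  have "gpath E (rev (p # rs @ [q]))" using path unfolding gpath_def successively_rev by auto
  then have "gpath E (q # rev rs @ [p])" by simp
  from no_long_connection_le[OF bowtie_swap[OF b] this] False dis have "rev rs = []" by auto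
  then show ?thesis by simp
qed

text \<open>
  Hence every path between the lobes that avoids \<open>m\<close> contains an edge from one lobe to the other.
  This is the main tool: exhibiting several paths between known vertices of the lobes forces several
  such edges.
\<close>

lemma crossing_edge:
  assumes b: "bowtie m as bs" and path: "gpath E xs" "xs \<noteq> []" "m \<notin> set xs"
    and ends: "hd xs \<in> set as" "last xs \<in> set bs"
  obtains ys p q zs where "xs = ys @ p # q # zs" "p \<in> set as" "q \<in> set bs" "E p q"
proof -
  have "set as \<inter> set bs = {}" using b by (auto simp: bowtie_def)
  from split_at_crossing[OF path(2) ends this] obtain ys p rs q zs where
    xs: "xs = ys @ p # rs @ q # zs" and p: "p \<in> set as" and q: "q \<in> set bs"
    and rs: "set rs \<inter> (set as \<union> set bs) = {}" by blast
  from split_list[OF p] obtain as1 as2 where as: "as = as1 @ p # as2" by blast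
  from split_list[OF q] obtain bs1 bs2 where bs: "bs = bs1 @ q # bs2" by blast
  have "gpath E (p # rs @ [q])"
    using path(1) unfolding xs gpath_def by (auto simp: successively_append_iff successively_Cons hd_append)
  then have rs0: "rs = []" using no_long_connection[of m as1 p as2 bs1 q bs2 rs] b rs path(3)
    unfolding as bs xs by auto
  moreover have "E p q" using path(1) unfolding xs rs0 gpath_def by (simp add: successively_append_iff)
  ultimately show ?thesis using that xs p q by simp
qed

section \<open>Squares have diagonals\<close>

text \<open>
  If \<open>x\<close> and \<open>z\<close> were not adjacent, there would be a bowtie at \<open>m\<close>, and the path \<open>x, n, z\<close>
  would put \<open>n\<close> on one of its lobes, say on that of \<open>z\<close>. Then \<open>n\<close> is a neighbour of both \<open>x\<close>
  and \<open>z\<close>, and all nine vertices can be traversed in two ways with the same ends: after the lobe of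
  \<open>x\<close>, the part between \<open>n\<close> and \<open>m\<close> can be run through in either direction before continuing
  from \<open>z\<close>.
\<close>

lemma square_diagonal:
  assumes "E x m" "E m z" "E z n" "E n x" "x \<noteq> z" "m \<noteq> n"
  shows "E x z"
proof (rule ccontr)
  have no_right: False
    if b: "bowtie m as bs" and hd: "hd as = x" "hd bs = z" and n: "n \<in> set bs"
      and e: "E x n" "E n z" for as bs x z
  proof -
    have "z \<noteq> n" using e irrefl by auto
    obtain bs' where bs': "bs = z # bs'" using hd n by (cases bs) auto
    with n \<open>z \<noteq> n\<close> have "n \<in> set bs'" by simp
    from split_list[OF this] bs' obtain cs1 cs2 where bs: "bs = z # cs1 @ n # cs2" by blast
    have ne: "as \<noteq> []" using b by (auto simp: bowtie_def)
    have *: "successively E (rev as)" using b by (auto simp: bowtie_def)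
    have l: "last (rev as) = x" using ne hd by (simp add: last_rev)
    have "E m x" and mz: "E m z" using b hd by (auto simp: bowtie_def)
    then have mx: "E x m" by (blast intro: sym)
    have c: "successively E (m # rev cs2 @ [n])" "successively E (n # cs2 @ [m])" "successively E (z # cs1)"
      using bowtie_arcs_right(2,3)[of m as "z # cs1" n cs2] b unfolding bs
      by (auto simp: bowtie_def successively_append_iff successively_Cons)
    have d: "distinct (m # as @ z # cs1 @ n # cs2)" "length as + length cs1 + length cs2 = 6"
      using b unfolding bs by (auto simp: bowtie_def)
    have "successively E ((n # cs2) @ m # z # cs1)"
      using c mz by (subst successively_join) (auto simp: successively_Cons)
    then have "gpath E (rev as @ n # cs2 @ m # z # cs1)"
      using * l ne e d by (auto simp: gpath_def successively_append_iff)
    moreover have "successively E ((m # rev cs2) @ n # z # cs1)"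
      using c e by (subst successively_join) (auto simp: successively_Cons)
    then have "gpath E (rev as @ m # rev cs2 @ n # z # cs1)"
      using * l ne mx d by (auto simp: gpath_def successively_append_iff)
    ultimately have "rev as @ n # cs2 @ m # z # cs1 = rev as @ m # rev cs2 @ n # z # cs1"
      by (rule path9_unique) (use d(2) ne in simp_all)
    then have "n = m" by (metis same_append_eq list.inject)
    then show False using d(1) by simp
  qed
  assume "\<not> E x z"
  from bowtie_exists[OF assms(1,2,5) this] obtain as bs where
    b: "bowtie m as bs" and hd: "hd as = x" "hd bs = z" by blast
  have "as \<noteq> []" "bs \<noteq> []" using b by (auto simp: bowtie_def)
  then have in_sets: "x \<in> set as" "z \<in> set bs" using hd by auto
  have "x \<noteq> n" "z \<noteq> n" "x \<noteq> m" "z \<noteq> m" using assms irrefl by auto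
  moreover have nx: "E x n" "E n z" using assms by (blast intro: sym)+
  ultimately have "gpath E [x, n, z]" "m \<notin> set [x, n, z]" using assms by (auto simp: gpath_def)
  moreover have h: "hd [x, n, z] \<in> set as" "last [x, n, z] \<in> set bs" using in_sets by simp_all
  ultimately obtain ys p q zs where
    c: "[x, n, z] = ys @ p # q # zs" "p \<in> set as" "q \<in> set bs"
    using crossing_edge[OF b, of "[x, n, z]" thesis] by simp
  have "n = p \<or> n = q" using c(1) by (auto simp: Cons_eq_append_conv)
  with c have "n \<in> set as \<or> n \<in> set bs" by blast
  then show False
  proof
    assume "n \<in> set bs"
    from no_right[OF b hd this nx] show False .
  next
    assume "n \<in> set as"
    from no_right[OF bowtie_swap[OF b] hd(2,1) this sym[OF nx(2)] sym[OF nx(1)]] show False .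
  qed
qed

text \<open>
  A cycle of length 4 induces a complete graph by the preceding lemma, so \<open>m\<close> is reached from
  \<open>a1\<close> along two different paths through \<open>a2\<close> and \<open>a3\<close>; the five vertices of the other lobe
  prolong both to eight edges.
\<close>

lemma no_square_bowtie: "\<not> bowtie m [a1, a2, a3] bs"
proof
  assume b: "bowtie m [a1, a2, a3] bs"
  then have e: "E m a1" "E a1 a2" "E a2 a3" "E m a3" and d: "distinct ([a1, a2, a3, m] @ bs)"
    and bs: "successively E (m # bs)" "length bs = 5"
    by (auto simp: bowtie_def successively_Cons)
  note e' = e[THEN sym]
  have diag: "E a1 a3" "E m a2"
    using d by (auto intro: square_diagonal[OF e'(1) e(4) e'(3) e'(2)]
      square_diagonal[OF e(1) e(2) e(3) e'(4)])
  have "successively E ([a1, a2, a3, m] @ bs)" "successively E ([a1, a3, a2, m] @ bs)"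
    using e e' diag diag(2)[THEN sym] bs by simp_all
  then have "gpath E ([a1, a2, a3, m] @ bs)" "gpath E ([a1, a3, a2, m] @ bs)"
    using d unfolding gpath_def by auto
  then have "[a1, a2, a3, m] @ bs = [a1, a3, a2, m] @ bs"
    by (rule path9_unique) (use bs(2) in simp_all)
  then have "a2 = a3" by (metis append_Cons list.inject)
  then show False using d by simp
qed

section \<open>The possible bowties\<close>

text \<open>
  With lobes of length 3 excluded, the four forbidden cycle lengths determine where an edge between
  the lobes can attach: the cycles have lengths 3 and 7 or both 5, and on a cycle of length 5 or 7
  the end of the edge is one of the two vertices farthest from \<open>m\<close>.
\<close>

lemma crossing_types:
  assumes b: "bowtie m as bs" and "p \<in> set as" "q \<in> set bs" "E p q"
  shows "(length as = 2 \<and> length bs = 6 \<and> q \<in> {bs ! 2, bs ! 3}) \<or>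
    (length as = 6 \<and> length bs = 2 \<and> p \<in> {as ! 2, as ! 3}) \<or>
    (length as = 4 \<and> length bs = 4 \<and> p \<in> {as ! 1, as ! 2} \<and> q \<in> {bs ! 1, bs ! 2})"
proof -
  from split_list[OF assms(2)] obtain as1 as2 where as: "as = as1 @ p # as2" by blast
  from split_list[OF assms(3)] obtain bs1 bs2 where bs: "bs = bs1 @ q # bs2" by blast
  have "p \<noteq> q" using assms irrefl by auto
  then have g: "gpath E (p # [] @ [q])" using assms by (simp add: gpath_def)
  note len = connection_lengths[OF b[unfolded as bs] g]
  have "length as \<noteq> 3"
  proof
    assume "length as = 3"
    then obtain a1 a2 a3 where "as = [a1, a2, a3]" by (auto simp: length_Suc_conv numeral_3_eq_3)
    then show False using no_square_bowtie b by blast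
  qed
  moreover have "length bs \<noteq> 3"
  proof
    assume "length bs = 3"
    then obtain a1 a2 a3 where "bs = [a1, a2, a3]" by (auto simp: length_Suc_conv numeral_3_eq_3)
    then show False using no_square_bowtie bowtie_swap[OF b] by blast
  qed
  ultimately have ne: "length as1 + length as2 \<noteq> 2" "length bs1 + length bs2 \<noteq> 2"
    by (auto simp: as bs)
  have "(length as1 + length as2 = 1 \<and> length bs1 + length bs2 = 5 \<and> (length bs1 = 2 \<or> length bs1 = 3)) \<or>
    (length as1 + length as2 = 5 \<and> length bs1 + length bs2 = 1 \<and> (length as1 = 2 \<or> length as1 = 3)) \<or>
    (length as1 + length as2 = 3 \<and> length bs1 + length bs2 = 3 \<and>
      (length as1 = 1 \<or> length as1 = 2) \<and> (length bs1 = 1 \<or> length bs1 = 2))"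
    using connection_arith(2)[OF len] ne by simp
  then show ?thesis by (auto simp: as bs nth_append)
qed

text \<open>
  The graph stays connected without \<open>m\<close>, so some path joins the two lobes away from \<open>m\<close>.
\<close>

lemma crossing_exists:
  assumes b: "bowtie m as bs"
  obtains p q where "p \<in> set as" "q \<in> set bs" "E p q"
proof -
  have ne: "hd as \<in> set as" "hd bs \<in> set bs" using b by (auto simp: bowtie_def intro!: hd_in_set)
  then have "hd as \<noteq> m" "hd bs \<noteq> m" using b by (auto simp: bowtie_def)
  moreover have "E m (hd as)" "E m (hd bs)" using b by (auto simp: bowtie_def)
  then have "hd as \<in> V" "hd bs \<in> V" using in_V sym by blast+
  ultimately obtain xs where "gpath E xs" "xs \<noteq> []" "m \<notin> set xs" "hd xs = hd as" "last xs = hd bs"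
    using connected_minus by metis
  then show ?thesis using crossing_edge[OF b, of xs] ne that by metis
qed

text \<open>
  The form of the crossing edge that is used for two cycles of length 5 whose lobes start with the
  given nonadjacent vertices \<open>x\<close> and \<open>z\<close>: as neighbours of \<open>m\<close>, these are not ends of a
  crossing edge.
\<close>

lemma crossing_inner:
  assumes b: "bowtie m [x, c1, c2, c3] [z, d1, d2, d3]"
    and path: "gpath E xs" "m \<notin> set xs" "xs \<noteq> []" "hd xs = x" "last xs = z"
  obtains ys p q zs where "xs = ys @ p # q # zs" "p \<in> {c1, c2}" "q \<in> {d1, d2}"
proof -
  obtain ys p q zs where xs: "xs = ys @ p # q # zs"
    and pq: "p \<in> set [x, c1, c2, c3]" "q \<in> set [z, d1, d2, d3]" "E p q"
  proof (rule crossing_edge[OF b path(1,3,2)])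
    show "hd xs \<in> set [x, c1, c2, c3]" "last xs \<in> set [z, d1, d2, d3]" using path(4,5) by simp_all
  qed blast
  from crossing_types[OF b pq] have "p \<in> {c1, c2}" "q \<in> {d1, d2}" by simp_all
  with xs show ?thesis using that by blast
qed

text \<open>
  The edge \<open>a1 b3\<close> is the only one up to symmetry. The vertices \<open>m\<close> and \<open>b2\<close> are not adjacent
  and have the common neighbour \<open>b1\<close>, so there is a second bowtie, at \<open>b1\<close>. Neither of its cycles
  is a triangle: a common neighbour of \<open>b1\<close> with \<open>m\<close> or with \<open>b2\<close> lies outside the first
  bowtie, and inserting it into the cycle of length 7 gives length 8. So both cycles have length 5.
  The path \<open>m, a1, b3, b2\<close> has to cross on its middle edge, and the path along \<open>b6, b5, b4, b3\<close>
  has to cross at a second vertex. The two crossing vertices on the lobe of \<open>m\<close> are adjacent,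
  which makes \<open>a1\<close> adjacent to one of \<open>b4\<close>, \<open>b5\<close>, \<open>b6\<close>, and that is impossible.
\<close>

lemma no_triangle_heptagon_bowtie:
  assumes b: "bowtie m [a1, a2] [b1, b2, b3, b4, b5, b6]" and c: "E a1 b3"
  shows False
proof -
  have e0: "E m a1" "E a1 a2" "E m a2" "E m b1" "E b1 b2" "E b2 b3" "E b3 b4" "E b4 b5" "E b5 b6" "E m b6"
    and d: "distinct [m, a1, a2, b1, b2, b3, b4, b5, b6]"
    using b by (simp_all add: bowtie_def)
  note e = e0 e0[THEN sym] c c[THEN sym]
  have no8: False if "distinct xs" "successively E xs" "E (last xs) (hd xs)" "length xs = 8" for xs
  proof -
    have "gcycle E xs" using that by (auto simp: gcycle_def gpath_def)
    from no_cycle[OF this] that(4) show False by simp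
  qed
  \<comment> \<open>entry 2 is where the pairs of paths used below first differ\<close>
  have uniq: "xs ! 2 = ys ! 2" if "distinct xs" "distinct ys" "successively E xs" "successively E ys"
    "length xs = 9" "length ys = 9" "hd xs = hd ys" "last xs = last ys" for xs ys
    using path9_unique[of xs ys] that by (simp add: gpath_def)
  have a1: "\<not> E a1 b1" "\<not> E a1 b5" "\<not> E a1 b6" and a2: "\<not> E a2 b1"
    using crossing_types[OF b, of a1 b1] crossing_types[OF b, of a1 b5]
      crossing_types[OF b, of a1 b6] crossing_types[OF b, of a2 b1] d by auto
  have a1b4: "\<not> E a1 b4"
    using no8[of "[a1, b4, b5, b6, m, b1, b2, b3]"] e d by auto
  have "\<not> E m b2"
    using uniq[of "[a2, a1, m, b6, b5, b4, b3, b2, b1]" "[a2, a1, b3, b4, b5, b6, m, b2, b1]"] e d by auto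
  have b1b3: "\<not> E b1 b3"
  proof
    assume "E b1 b3"
    note this this[THEN sym]
    then show False
      using uniq[of "[a2, a1, b3, b4, b5, b6, m, b1, b2]" "[a2, a1, m, b6, b5, b4, b3, b1, b2]"] e d by auto
  qed
  have b1b: "\<not> E b1 b4" "\<not> E b1 b5" "\<not> E b1 b6"
    using no8[of "[b1, b4, b5, b6, m, a1, b3, b2]"] no8[of "[b1, b5, b6, m, a2, a1, b3, b2]"]
      no8[of "[b6, b5, b4, b3, a1, a2, m, b1]"] e d by auto
  have outside: "w \<notin> set [m, a1, a2, b1, b2, b3, b4, b5, b6]"
    if "E b1 w" "w \<noteq> m" "w \<noteq> b2" for w
    using that a1(1) a2 b1b3 b1b irrefl[of b1] sym[of b1 a1] sym[of b1 a2] by auto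
  have no_m: "\<not> E m w" if "E b1 w" "w \<noteq> m" "w \<noteq> b2" for w
    using no8[of "[w, b1, b2, b3, b4, b5, b6, m]"] outside[OF that] sym[OF that(1)] e d by auto
  have no_b2: "\<not> E b2 w" if "E b1 w" "w \<noteq> m" "w \<noteq> b2" for w
    using no8[of "[w, b2, b3, b4, b5, b6, m, b1]"] outside[OF that] that(1) sym[of b2 w] e d by auto
  obtain as bs where b': "bowtie b1 as bs" and hd: "hd as = m" "hd bs = b2"
    using bowtie_exists[of m b1 b2] e d \<open>\<not> E m b2\<close> by auto
  have "length as \<noteq> 2"
  proof
    assume "length as = 2"
    with hd obtain w where "as = [m, w]" by (auto simp: length_Suc_conv numeral_2_eq_2)
    with b' hd no_m[of w] show False by (cases bs) (auto simp: bowtie_def)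
  qed
  moreover have "length bs \<noteq> 2"
  proof
    assume "length bs = 2"
    with hd obtain w where "bs = [b2, w]" by (auto simp: length_Suc_conv numeral_2_eq_2)
    with b' hd no_b2[of w] show False by (cases as) (auto simp: bowtie_def)
  qed
  moreover obtain p q where "p \<in> set as" "q \<in> set bs" "E p q" using crossing_exists[OF b'] by blast
  ultimately have "length as = 4" "length bs = 4" using crossing_types[OF b', of p q] by blast+
  with hd obtain c1 c2 c3 d1 d2 d3 where as: "as = [m, c1, c2, c3]" and bs: "bs = [b2, d1, d2, d3]"
    by (auto simp: length_Suc_conv numeral_eq_Suc)
  have b'': "bowtie b1 [m, c1, c2, c3] [b2, d1, d2, d3]" using b' as bs by simp
  have dd: "distinct [m, c1, c2, c3, b2, d1, d2, d3]" and "E c1 c2"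
    using b'' by (auto simp: bowtie_def)
  have "gpath E [m, a1, b3, b2]" "b1 \<notin> set [m, a1, b3, b2]"
    and "gpath E [m, b6, b5, b4, b3, b2]" "b1 \<notin> set [m, b6, b5, b4, b3, b2]"
    using e d by (auto simp: gpath_def)
  note paths = this
  obtain ys p q zs where
    1: "[m, a1, b3, b2] = ys @ p # q # zs" "p \<in> {c1, c2}" "q \<in> {d1, d2}"
    using crossing_inner[OF b'', of "[m, a1, b3, b2]" thesis] paths by simp
  obtain ys' p' q' zs' where
    2: "[m, b6, b5, b4, b3, b2] = ys' @ p' # q' # zs'" "p' \<in> {c1, c2}" "q' \<in> {d1, d2}"
    using crossing_inner[OF b'', of "[m, b6, b5, b4, b3, b2]" thesis] paths by simp
  have ne: "p \<noteq> m" "q \<noteq> b2" "p' \<noteq> m" "q' \<noteq> b2" using 1 2 dd by auto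
  have "p = a1 \<and> q = b3" using 1(1) ne by (auto simp: Cons_eq_append_conv)
  moreover have "p' = b6 \<or> p' = b5 \<or> p' = b4 \<or> p' = b3" using 2(1) ne by (auto simp: Cons_eq_append_conv)
  ultimately have "E a1 p'" "p' \<in> {b4, b5, b6}"
    using 1 2 dd \<open>E c1 c2\<close> sym[OF \<open>E c1 c2\<close>] d by auto
  then show False using a1 a1b4 by auto
qed

text \<open>
  A triangle would lead, after reversing lobes, to the configuration just excluded.
\<close>

lemma bowtie_shape:
  assumes b: "bowtie m as bs"
  shows "length as = 4 \<and> length bs = 4"
proof -
  have no2: False
    if b: "bowtie m as bs" and l: "length as = 2" "length bs = 6"
      and pq: "p \<in> set as" "q \<in> {bs ! 2, bs ! 3}" "E p q" for as bs p q
  proof -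
    have base: False if h: "bowtie m as bs" "length as = 2" "length bs = 6" "E (as ! 0) (bs ! 2)" for as bs
    proof -
      obtain a1 a2 where "as = [a1, a2]" using h(2) by (auto simp: length_Suc_conv numeral_eq_Suc)
      moreover obtain b1 b2 b3 b4 b5 b6 where "bs = [b1, b2, b3, b4, b5, b6]"
        using h(3) by (auto simp: length_Suc_conv numeral_eq_Suc)
      ultimately show False using h no_triangle_heptagon_bowtie by auto
    qed
    have "p = as ! 0 \<or> p = rev as ! 0" using l pq(1) by (auto simp: length_Suc_conv numeral_2_eq_2)
    moreover have "q = bs ! 2 \<or> q = rev bs ! 2" using l pq(2) by (auto simp: rev_nth)
    ultimately show False
      using base[of as bs] base[of "rev as" bs] base[of as "rev bs"] base[of "rev as" "rev bs"]
        bowtie_rev_left[OF b] bowtie_rev_right[OF b] bowtie_rev_right[OF bowtie_rev_left[OF b]] b l pq(3)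
      by auto
  qed
  obtain p q where pq: "p \<in> set as" "q \<in> set bs" "E p q" using crossing_exists[OF b] by blast
  from crossing_types[OF b this] show ?thesis
    using no2[OF b _ _ pq(1) _ pq(3)] no2[OF bowtie_swap[OF b] _ _ pq(2) _ sym[OF pq(3)]] by blast
qed

text \<open>
  Suppose first that \<open>m\<close> and \<open>a2\<close> are not adjacent. Their common neighbour \<open>a1\<close> is then the
  centre of a second bowtie of two cycles of length 5. Three paths from \<open>m\<close> to \<open>a2\<close> have to cross
  it, and they leave the lobe of \<open>m\<close> in three different vertices, whereas only two are possible. So
  \<open>m\<close> and \<open>a2\<close> are adjacent, and the diagonals of the resulting squares complete a cycle of
  length 8.
\<close>

lemma no_pentagon_bowtie:
  assumes b: "bowtie m [a1, a2, a3, a4] [b1, b2, b3, b4]" and c: "E a2 b2"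
  shows False
proof -
  have e0: "E m a1" "E a1 a2" "E a2 a3" "E a3 a4" "E m a4" "E m b1" "E b1 b2" "E b2 b3" "E b3 b4" "E m b4"
    and d: "distinct [m, a1, a2, a3, a4, b1, b2, b3, b4]"
    using b by (simp_all add: bowtie_def)
  note e = e0 e0[THEN sym] c c[THEN sym]
  have ma2: "E m a2"
  proof (rule ccontr)
    assume "\<not> E m a2"
    then obtain as bs where b': "bowtie a1 as bs" and hd: "hd as = m" "hd bs = a2"
      using bowtie_exists[of m a1 a2] e d by auto
    from bowtie_shape[OF b'] hd obtain c1 c2 c3 d1 d2 d3 where
      "as = [m, c1, c2, c3]" "bs = [a2, d1, d2, d3]"
      by (auto simp: length_Suc_conv numeral_eq_Suc)
    with b' have b'': "bowtie a1 [m, c1, c2, c3] [a2, d1, d2, d3]" by simp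
    then have dd: "distinct [m, c1, c2, a2, d1, d2]" by (auto simp: bowtie_def)
    have g: "gpath E [m, a4, a3, a2]" "a1 \<notin> set [m, a4, a3, a2]"
      "gpath E [m, b1, b2, a2]" "a1 \<notin> set [m, b1, b2, a2]"
      "gpath E [m, b4, b3, b2, a2]" "a1 \<notin> set [m, b4, b3, b2, a2]"
      using e d by (auto simp: gpath_def)
    obtain ys p q zs where 1: "[m, a4, a3, a2] = ys @ p # q # zs" "p \<in> {c1, c2}" "q \<in> {d1, d2}"
      using crossing_inner[OF b'', of "[m, a4, a3, a2]" thesis] g by simp
    have "p \<noteq> m" "q \<noteq> a2" using 1 dd by auto
    then have p: "p = a4" using 1(1) by (auto simp: Cons_eq_append_conv)
    obtain ys' p' q' zs' where 2: "[m, b1, b2, a2] = ys' @ p' # q' # zs'" "p' \<in> {c1, c2}" "q' \<in> {d1, d2}"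
      using crossing_inner[OF b'', of "[m, b1, b2, a2]" thesis] g by simp
    have "p' \<noteq> m" "q' \<noteq> a2" using 2 dd by auto
    then have p': "p' = b1" using 2(1) by (auto simp: Cons_eq_append_conv)
    obtain ys'' p'' q'' zs'' where 3: "[m, b4, b3, b2, a2] = ys'' @ p'' # q'' # zs''" "p'' \<in> {c1, c2}" "q'' \<in> {d1, d2}"
      using crossing_inner[OF b'', of "[m, b4, b3, b2, a2]" thesis] g by simp
    have "p'' \<noteq> m" "q'' \<noteq> a2" using 3 dd by auto
    then have p'': "p'' = b4 \<or> p'' = b3" using 3(1) by (auto simp: Cons_eq_append_conv)
    show False using 1(2) 2(2) 3(2) p p' p'' d by auto
  qed
  have "E a2 a4" using square_diagonal[of a2 m a4 a3] ma2[THEN sym] e d by simp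
  moreover have "E a1 a3" using square_diagonal[of a1 m a3 a2] square_diagonal[of m a2 a3 a4] ma2 e d by simp
  ultimately have "gcycle E [a1, a3, a4, a2, b2, b3, b4, m]"
    using e d by (auto simp: gcycle_def gpath_def intro: sym)
  from no_cycle[OF this] show False by simp
qed

lemma no_bowtie: "\<not> bowtie m as bs"
proof
  assume b: "bowtie m as bs"
  have base: False if h: "bowtie m as bs" "length as = 4" "length bs = 4" "E (as ! 1) (bs ! 1)" for as bs
  proof -
    obtain a1 a2 a3 a4 where "as = [a1, a2, a3, a4]" using h(2) by (auto simp: length_Suc_conv numeral_eq_Suc)
    moreover obtain b1 b2 b3 b4 where "bs = [b1, b2, b3, b4]"
      using h(3) by (auto simp: length_Suc_conv numeral_eq_Suc)
    ultimately show False using h no_pentagon_bowtie by auto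
  qed
  have l: "length as = 4" "length bs = 4" using bowtie_shape[OF b] by auto
  obtain p q where pq: "p \<in> set as" "q \<in> set bs" "E p q" using crossing_exists[OF b] by blast
  from crossing_types[OF b this] l have "p \<in> {as ! 1, as ! 2}" "q \<in> {bs ! 1, bs ! 2}" by auto
  then have "p = as ! 1 \<or> p = rev as ! 1" "q = bs ! 1 \<or> q = rev bs ! 1" using l by (auto simp: rev_nth)
  then show False
    using base[of as bs] base[of "rev as" bs] base[of as "rev bs"] base[of "rev as" "rev bs"]
      bowtie_rev_left[OF b] bowtie_rev_right[OF b] bowtie_rev_right[OF bowtie_rev_left[OF b]] b l pq(3)
    by auto
qed

section \<open>Completeness\<close>

text \<open>
  Without bowties, vertices with a common neighbour are adjacent, so the graph, being connected, is
  complete.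
\<close>

lemma complete:
  assumes "x \<in> V" "y \<in> V" "x \<noteq> y"
  shows "E x y"
proof -
  have "\<not> V \<subseteq> {x, y}"
  proof
    assume "V \<subseteq> {x, y}"
    then have "card V \<le> card {x, y}" by (intro card_mono) auto
    also have "\<dots> \<le> 2" using card_insert_le_m1[of 2 "{y}" x] by simp
    finally show False using card_V by simp
  qed
  then obtain m where "m \<in> V" "m \<noteq> x" "m \<noteq> y" by blast
  then obtain xs where xs: "gpath E xs" "xs \<noteq> []" "hd xs = x" "last xs = y"
    using connected_minus[of x y m] assms by blast
  have "successively E xs \<Longrightarrow> xs \<noteq> [] \<Longrightarrow> hd xs = last xs \<or> E (hd xs) (last xs)" for xs
  proof (induction xs rule: induct_list012)
    case (3 u v xs)
    then have "E u v" and "v = last (v # xs) \<or> E v (last (v # xs))" by auto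
    then show ?case using bowtie_exists[of u v "last (v # xs)"] no_bowtie by fastforce
  qed auto
  from this[of xs] show ?thesis using xs assms by (simp add: gpath_def)
qed

text \<open>
  A complete graph on at least nine vertices contains a cycle of length 9.
\<close>

lemma inconsistent: False
proof -
  obtain ws where ws: "set ws = V" "distinct ws" using finite_distinct_list[OF finite_V] by blast
  define xs where "xs = take 9 ws"
  have "length ws = card V" using ws distinct_card by fastforce
  then have len: "length xs = 9" using card_V by (simp add: xs_def)
  have dist: "distinct xs" and sub: "set xs \<subseteq> V" using ws by (auto simp: xs_def dest: in_set_takeD)
  have "successively E ys" if "distinct ys" "set ys \<subseteq> V" for ys
    using that by (induction ys rule: induct_list012) (auto intro: complete)
  then have "successively E xs" using dist sub by blast
  moreover have "hd xs \<noteq> last xs" using dist len by (cases xs) (auto split: if_splits)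
  moreover have "xs \<noteq> []" using len by auto
  ultimately have "gcycle E xs"
    using dist sub complete[of "last xs" "hd xs"] by (auto simp: gcycle_def gpath_def subset_iff)
  from no_cycle[OF this] len show False by simp
qed

end

section \<open>From vertex lists to the cycles of a graph\<close>

lemma walk_arcs:
  "pcas x (zip (x # xs) (xs @ [y])) y"
  "pawalk_verts x (zip (x # xs) (xs @ [y])) = x # xs @ [y]"
  "successively (\<lambda>u v. (u, v) \<in> A) (x # xs @ [y]) \<longleftrightarrow> set (zip (x # xs) (xs @ [y])) \<subseteq> A"
  by (induction xs arbitrary: x) auto

text \<open>
  The subgraph that \<open>cycles_of\<close> assigns to a cycle, described by its vertex list.
\<close>

definition cycle_graph :: "'a list \<Rightarrow> 'a pair_pre_digraph" where
  "cycle_graph xs = \<lparr> pverts = set xs,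
     parcs = set (zip xs (rotate1 xs)) \<union> (set (zip xs (rotate1 xs)))\<inverse> \<rparr>"

lemma gcycle_in_cycles_of:
  assumes c: "gcycle (\<lambda>u v. (u, v) \<in> parcs H) xs" and v: "set xs \<subseteq> pverts H" and l: "3 \<le> length xs"
  shows "cycle_graph xs \<in> cycles_of H (length xs)"
proof -
  obtain x xs' where xs: "xs = x # xs'" using l by (cases xs) auto
  let ?p = "zip (x # xs') (xs' @ [x])"
  have "successively (\<lambda>u v. (u, v) \<in> parcs H) (xs @ [x])"
    using c unfolding successively_append_iff by (simp add: gcycle_def gpath_def xs)
  then have "set ?p \<subseteq> parcs H"
    using walk_arcs(3)[of "parcs H" x xs' x] xs by simp
  then have "pre_digraph.cycle (with_proj H) ?p"
    using c v walk_arcs(1,2)[where x = x and xs = xs' and y = x]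
    unfolding pre_digraph.cycle_def pre_digraph.awalk_def cas_with_proj_eq awalk_verts_with_proj_eq xs
    by (auto simp: gcycle_def gpath_def intro!: exI[of _ x])
  moreover have "fst ` set ?p = set xs"
    unfolding set_map[symmetric] by (simp add: xs)
  ultimately show ?thesis
    using l unfolding cycles_of_def cycle_graph_def by (auto simp: xs intro!: exI[of _ ?p])
qed

lemma pcas_successively:
  assumes "pcas u p v" "set p \<subseteq> A"
  shows "successively (\<lambda>x y. (x, y) \<in> A) (map fst p @ [v]) \<and> pawalk_verts u p = map fst p @ [v]
    \<and> hd (map fst p @ [v]) = u"
  using assms by (induction p arbitrary: u) (auto simp: successively_Cons)

lemma cycles_of_gcycle:
  assumes "C \<in> cycles_of H k"
  obtains xs where "gcycle (\<lambda>u v. (u, v) \<in> parcs H) xs" "length xs = k"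
proof -
  from assms obtain p u where p: "length p = k" "p \<noteq> []" "pcas u p u" "set p \<subseteq> parcs H"
    "distinct (tl (pawalk_verts u p))"
    unfolding cycles_of_def pre_digraph.cycle_def pre_digraph.awalk_def cas_with_proj_eq
      awalk_verts_with_proj_eq by auto
  have s: "successively (\<lambda>x y. (x, y) \<in> parcs H) (map fst p @ [u])"
    "pawalk_verts u p = map fst p @ [u]" "hd (map fst p @ [u]) = u"
    using pcas_successively[OF p(3,4)] by auto
  from p(2) s(3) have p': "map fst p = u # tl (map fst p)" by (cases p) auto
  have "distinct (map fst p)"
    using p(5) unfolding s(2) by (subst p') (subst (asm) p', simp)
  moreover have "successively (\<lambda>x y. (x, y) \<in> parcs H) (map fst p)" "(last (map fst p), u) \<in> parcs H"
    using s(1) p(2) by (auto simp only: successively_append_iff list.sel map_is_Nil_conv)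
  moreover have "hd (map fst p) = u" using p' by (metis list.sel(1))
  ultimately have "gcycle (\<lambda>u v. (u, v) \<in> parcs H) (map fst p)"
    using p(2) by (simp add: gcycle_def gpath_def)
  then show ?thesis using that p(1) by simp
qed

lemma gcycle_rotate: "gcycle E (us @ vs) \<Longrightarrow> gcycle E (vs @ us)"
  by (cases "us = []"; cases "vs = []") (auto simp: gcycle_def gpath_def successively_append_iff)

text \<open>
  A cycle that exists only after an edge \<open>xy\<close> has been added uses this edge. Rotating the cycle so
  that the edge closes it, and reversing it if necessary, leaves a path from \<open>x\<close> to \<open>y\<close> in the
  original graph; distinctness prevents a second use of the edge.
\<close>

lemma path_through_missing_edge:
  assumes c: "gcycle F xs" and l: "3 \<le> length xs" and n: "\<not> gcycle E xs"
    and F: "\<And>u v. F u v \<Longrightarrow> E u v \<or> (u = x \<and> v = y) \<or> (u = y \<and> v = x)"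
    and sym: "\<And>u v. E u v \<Longrightarrow> E v u"
  obtains zs where "gpath E zs" "length zs = length xs" "hd zs = x" "last zs = y"
proof -
  \<comment> \<open>rotate a missing arc to the closing position\<close>
  have "\<exists>zs. gcycle F zs \<and> length zs = length xs \<and> \<not> E (last zs) (hd zs)"
  proof (cases "successively E xs")
    case True
    then show ?thesis using c n by (auto simp: gcycle_def gpath_def)
  next
    case False
    have "\<exists>us a b vs. zs = us @ a # b # vs \<and> \<not> E a b" if "\<not> successively E zs" for zs
      using that
    proof (induction zs rule: induct_list012)
      case (3 u v zs)
      show ?case
      proof (cases "E u v")
        case True
        with 3 obtain us a b vs where "v # zs = us @ a # b # vs" "\<not> E a b" by auto
        then have "u # v # zs = (u # us) @ a # b # vs \<and> \<not> E a b" by simp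
        then show ?thesis by blast
      next
        case False
        then have "u # v # zs = [] @ u # v # zs \<and> \<not> E u v" by simp
        then show ?thesis by blast
      qed
    qed auto
    from this[OF False] obtain us a b vs where xs: "xs = (us @ [a]) @ (b # vs)" "\<not> E a b" by auto
    from gcycle_rotate[OF c[unfolded xs(1)]] xs show ?thesis
      by (intro exI[of _ "(b # vs) @ us @ [a]"]) simp
  qed
  then obtain zs where zs: "gcycle F zs" "length zs = length xs" "\<not> E (last zs) (hd zs)" by blast
  then have ends: "(last zs = x \<and> hd zs = y) \<or> (last zs = y \<and> hd zs = x)"
    using F by (auto simp: gcycle_def)
  obtain z ws w where zs': "zs = z # ws @ [w]" "ws \<noteq> []"
  proof -
    obtain z zs1 where "zs = z # zs1" "2 \<le> length zs1" using zs(2) l by (cases zs) auto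
    moreover from this obtain ws w where "zs1 = ws @ [w]" by (cases zs1 rule: rev_cases) auto
    moreover from calculation have "ws \<noteq> []" by auto
    ultimately show ?thesis using that by blast
  qed
  have d: "distinct (z # ws @ [w])" and s: "successively F (z # ws @ [w])"
    using zs(1) by (auto simp: zs' gcycle_def gpath_def)
  have xy: "{x, y} = {z, w}" using ends by (auto simp: zs')
  have "successively E (z # ws @ [w])"
  proof -
    have inner: "successively E ws" if "successively F ws" "set ws \<inter> {x, y} = {}" for ws
      using that(1) by (rule successively_mono) (use that(2) F in blast)
    have "E z (hd ws)" "E (last ws) w"
      using s d zs'(2) F[of z "hd ws"] F[of "last ws" w] xy hd_in_set[OF zs'(2)] last_in_set[OF zs'(2)]
      by (auto simp: successively_append_iff successively_Cons doubleton_eq_iff)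
    moreover have "successively E ws"
      using inner[of ws] s d xy by (auto simp: successively_append_iff successively_Cons)
    ultimately show ?thesis using zs'(2) by (simp add: successively_append_iff successively_Cons)
  qed
  then have g: "gpath E zs" using d by (simp add: gpath_def zs')
  moreover have "gpath E (rev zs)"
  proof -
    have "(\<lambda>u v. E v u) = E" using sym by blast
    then have "successively (\<lambda>u v. E v u) zs = successively E zs" by (rule arg_cong)
    then show ?thesis using g by (simp add: gpath_def)
  qed
  ultimately show ?thesis
    using that[of zs] that[of "rev zs"] ends zs(2) zs'(1) by (auto simp: hd_rev last_rev)
qed

text \<open>
  The edges of a path, as a symmetric set of arcs. Two paths with the same start and the same edges
  are equal, since the start lies on only one edge and the rest follows inductively.
\<close>

definition edge_pairs :: "'a list \<Rightarrow> 'a rel" where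
  "edge_pairs xs = set (zip xs (tl xs)) \<union> (set (zip xs (tl xs)))\<inverse>"

lemma edge_pairs_Cons: "edge_pairs (x # y # ys) = {(x, y), (y, x)} \<union> edge_pairs (y # ys)"
  by (auto simp: edge_pairs_def)

lemma edge_pairs_single [simp]: "edge_pairs [x] = {}"
  by (simp add: edge_pairs_def)

lemma edge_pairs_subset: "edge_pairs xs \<subseteq> set xs \<times> set xs"
proof (cases xs)
  case (Cons x ys)
  then show ?thesis by (auto simp: edge_pairs_def dest: set_zip_leftD set_zip_rightD)
qed (simp add: edge_pairs_def)

lemma edge_pairs_inject:
  "distinct (x # xs) \<Longrightarrow> distinct (x # ys) \<Longrightarrow> edge_pairs (x # xs) = edge_pairs (x # ys) \<Longrightarrow> xs = ys"
proof (induction xs arbitrary: x ys)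
  case Nil
  then show ?case by (cases ys) (auto simp: edge_pairs_Cons)
next
  case (Cons v xs)
  then obtain w ys' where ys: "ys = w # ys'" by (cases ys) (auto simp: edge_pairs_Cons)
  have nin: "(x, u) \<notin> edge_pairs zs \<and> (u, x) \<notin> edge_pairs zs" if "x \<notin> set zs" for u zs
    using edge_pairs_subset[of zs] that by blast
  have x: "x \<notin> set (v # xs)" "x \<notin> set (w # ys')" using Cons.prems ys by auto
  have eq: "{(x, v), (v, x)} \<union> edge_pairs (v # xs) = {(x, w), (w, x)} \<union> edge_pairs (w # ys')"
    using Cons.prems(3) unfolding ys edge_pairs_Cons .
  have vw: "v = w" using eq nin[OF x(2), of v] x by blast
  have "edge_pairs zs = ({(x, v), (v, x)} \<union> edge_pairs zs) - {q. fst q = x \<or> snd q = x}"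
    if "x \<notin> set zs" for zs
    using nin[OF that] by auto
  from this[OF x(1)] this[OF x(2)] have "edge_pairs (v # xs) = edge_pairs (v # ys')"
    using eq vw by metis
  then have "xs = ys'" using Cons.IH[of v ys'] Cons.prems(1,2) vw ys by simp
  then show ?case using vw ys by simp
qed

lemma cycle_graph_edge_pairs:
  "xs \<noteq> [] \<Longrightarrow> parcs (cycle_graph xs) = edge_pairs xs \<union> {(last xs, hd xs), (hd xs, last xs)}"
proof -
  have "set (zip (x # xs) (xs @ [y])) = set (zip (x # xs) xs) \<union> {(last (x # xs), y)}" for x y :: 'a and xs
    by (induction xs arbitrary: x) auto
  then show "xs \<noteq> [] \<Longrightarrow> parcs (cycle_graph xs) = edge_pairs xs \<union> {(last xs, hd xs), (hd xs, last xs)}"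
    by (cases xs) (auto simp: cycle_graph_def edge_pairs_def)
qed

text \<open>
  Reachability yields a path: a repeated vertex cuts the path short.
\<close>

lemma connected_gpath:
  assumes "connected (with_proj G \<restriction> S)" "u \<in> S" "v \<in> S" "\<And>x y. (x, y) \<in> parcs G \<Longrightarrow> (y, x) \<in> parcs G"
  obtains xs where "gpath (\<lambda>x y. (x, y) \<in> parcs G) xs" "xs \<noteq> []" "set xs \<subseteq> S" "hd xs = u" "last xs = v"
proof -
  let ?A = "parcs (mk_symmetric (with_proj G \<restriction> S))"
  have A: "?A \<subseteq> parcs G \<inter> S \<times> S" using assms(4) by (auto simp: parcs_mk_symmetric)
  have "(u, v) \<in> rtrancl_on S ?A"
    using assms(1-3) by (auto simp: connected_def strongly_connected_def reachable_def)
  then have "\<exists>xs. gpath (\<lambda>x y. (x, y) \<in> parcs G) xs \<and> xs \<noteq> [] \<and> set xs \<subseteq> S \<and> hd xs = u \<and> last xs = v"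
  proof (induction rule: rtrancl_on.induct)
    case (rtrancl_on_refl w)
    then show ?case by (intro exI[of _ "[w]"]) (auto simp: gpath_def)
  next
    case (rtrancl_on_into_rtrancl_on a b c)
    then obtain xs where xs: "gpath (\<lambda>x y. (x, y) \<in> parcs G) xs" "xs \<noteq> []" "set xs \<subseteq> S"
      "hd xs = a" "last xs = b" by blast
    have bc: "(b, c) \<in> parcs G" "c \<in> S" using rtrancl_on_into_rtrancl_on A by auto
    show ?case
    proof (cases "c \<in> set xs")
      case True
      then obtain ys zs where s: "xs = ys @ c # zs" by (meson split_list)
      show ?thesis
        using xs s by (intro exI[of _ "ys @ [c]"]) (auto simp: gpath_def successively_append_iff hd_append)
    next
      case False
      then show ?thesis
        using xs bc by (intro exI[of _ "xs @ [c]"]) (auto simp: gpath_def successively_append_iff)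
    qed
  qed
  then show ?thesis using that by blast
qed

section \<open>The theorem\<close>

text \<open>
  Two paths with eight edges between \<open>x\<close> and \<open>y\<close> become two cycles of length 9 once the edge
  \<open>xy\<close> is added. As subgraphs these coincide by unique saturation. Removing \<open>xy\<close>, which belongs
  to neither path, shows that the paths have the same edges, hence are equal.
\<close>

lemma uniquely_cycle_saturated_imp_locale:
  assumes g: "pair_graph G" and conn: "k_connected 2 G" and card: "9 \<le> card (pverts G)"
    and sat: "uniquely_cycle_saturated 9 G"
    and no_even: "\<And>k. k \<in> {8, 10, 12} \<Longrightarrow> cycles_of G k = {}"
  shows "cycle9_saturated (pverts G) (\<lambda>x y. (x, y) \<in> parcs G)"
proof -
  interpret pair_graph G by (rule g)
  let ?E = "\<lambda>x y. (x, y) \<in> parcs G"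
  have inV: "x \<in> pverts G \<and> y \<in> pverts G" if "?E x y" for x y using that wellformed' by blast
  have sym: "?E y x" if "?E x y" for x y using arcs_symmetric[OF that] .
  have pathV: "set xs \<subseteq> pverts G" if "successively ?E xs" "2 \<le> length xs" for xs
    using that
  proof (induction xs rule: induct_list012)
    case (3 x y zs)
    then show ?case using inV by (cases zs) auto
  qed auto
  have no_cycle: "length xs \<notin> {8, 9, 10, 12}" if "gcycle ?E xs" for xs
  proof
    assume l: "length xs \<in> {8, 9, 10, 12}"
    then have "set xs \<subseteq> pverts G" using pathV[of xs] that by (auto simp: gcycle_def gpath_def)
    then have "cycles_of G (length xs) \<noteq> {}" using gcycle_in_cycles_of[of G xs] that l by auto
    then show False using sat no_even l by (auto simp: uniquely_cycle_saturated_def)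
  qed
  show ?thesis
  proof
    show "finite (pverts G)" by (rule pair_finite_verts)
    show "9 \<le> card (pverts G)" by (rule card)
    show "x \<in> pverts G" if "?E x y" for x y using inV that by blast
    show "?E y x" if "?E x y" for x y using sym that .
    show "\<not> ?E x x" for x using pair_no_loops[of "(x, x)"] by auto
    show "length xs \<notin> {8, 9, 10, 12}" if "gcycle ?E xs" for xs using no_cycle that .
  next
    fix x y assume xy: "x \<in> pverts G" "y \<in> pverts G" "x \<noteq> y" "\<not> ?E x y"
    then obtain C where "C \<in> cycles_of (add_edge G x y) 9"
      using sat unfolding uniquely_cycle_saturated_def by blast
    then obtain xs where xs: "gcycle (\<lambda>u v. (u, v) \<in> parcs (add_edge G x y)) xs" "length xs = 9"
      by (rule cycles_of_gcycle)
    have "\<not> gcycle ?E xs" using no_cycle xs(2) by auto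
    obtain zs where "gpath ?E zs" "length zs = length xs" "hd zs = x" "last zs = y"
    proof (rule path_through_missing_edge[OF xs(1) _ \<open>\<not> gcycle ?E xs\<close>, of x y])
      show "3 \<le> length xs" using xs(2) by simp
      show "?E u v \<or> u = x \<and> v = y \<or> u = y \<and> v = x" if "(u, v) \<in> parcs (add_edge G x y)" for u v
        using that by (auto simp: add_edge_def)
      show "?E v u" if "?E u v" for u v using sym that .
    qed
    then show "\<exists>xs. gpath ?E xs \<and> length xs = 9 \<and> hd xs = x \<and> last xs = y"
      using xs(2) by auto
  next
    fix xs ys assume p: "gpath ?E xs" "gpath ?E ys" and l: "length xs = 9" "length ys = 9"
      and ends: "hd xs = hd ys" "last xs = last ys"
    let ?x = "hd xs" and ?y = "last xs"
    have ne: "xs \<noteq> []" "ys \<noteq> []" using l by auto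
    have nonadj': "\<not> ?E ?y ?x"
      using no_cycle[of xs] p l ne by (auto simp: gcycle_def)
    then have nonadj: "\<not> ?E ?x ?y" "\<not> ?E ?y ?x" using sym by blast+
    have V: "set xs \<subseteq> pverts G" "set ys \<subseteq> pverts G"
      using pathV p l by (auto simp: gpath_def)
    have xyV: "?x \<in> pverts G" "?y \<in> pverts G" using V ne by (meson hd_in_set last_in_set subsetD)+
    have "?x \<noteq> ?y" using p l ne by (cases xs) (auto simp: gpath_def split: if_splits)
    with sat nonadj xyV have ex1: "\<exists>!C. C \<in> cycles_of (add_edge G ?x ?y) 9"
      unfolding uniquely_cycle_saturated_def by blast
    have in_C: "cycle_graph zs \<in> cycles_of (add_edge G ?x ?y) 9"
      if "gpath ?E zs" "length zs = 9" "hd zs = ?x" "last zs = ?y" "set zs \<subseteq> pverts G" for zs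
    proof -
      have "successively (\<lambda>u v. (u, v) \<in> parcs (add_edge G ?x ?y)) zs"
        by (rule successively_mono[of ?E]) (use that in \<open>auto simp: gpath_def add_edge_def\<close>)
      then have "gcycle (\<lambda>u v. (u, v) \<in> parcs (add_edge G ?x ?y)) zs"
        using that by (auto simp: gcycle_def gpath_def add_edge_def)
      from gcycle_in_cycles_of[OF this] that show ?thesis by (simp add: add_edge_def)
    qed
    have "cycle_graph xs = cycle_graph ys"
      using ex1 in_C[of xs] in_C[of ys] p l ends V by auto
    then have eq: "edge_pairs xs \<union> {(?y, ?x), (?x, ?y)} = edge_pairs ys \<union> {(?y, ?x), (?x, ?y)}"
      using cycle_graph_edge_pairs[of xs] cycle_graph_edge_pairs[of ys] ne ends by auto
    have sub: "edge_pairs zs \<subseteq> parcs G" if "gpath ?E zs" for zs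
    proof -
      have "set (zip zs (tl zs)) \<subseteq> parcs G" using that
        by (induction zs rule: induct_list012) (auto simp: gpath_def)
      then show ?thesis using sym unfolding edge_pairs_def by blast
    qed
    have "edge_pairs xs = edge_pairs ys" using eq sub[OF p(1)] sub[OF p(2)] nonadj by blast
    moreover obtain x xs' ys' where "xs = x # xs'" "ys = x # ys'"
      using ne ends by (cases xs; cases ys) auto
    ultimately show "xs = ys" using edge_pairs_inject[of x xs' ys'] p by (auto simp: gpath_def)
  next
    fix x y m assume xy: "x \<in> pverts G" "y \<in> pverts G" "x \<noteq> m" "y \<noteq> m"
    have "card ({m} \<inter> pverts G) < 2"
      using card_mono[of "{m}" "{m} \<inter> pverts G"] by simp
    then have "connected (with_proj G \<restriction> (pverts G - {m} \<inter> pverts G))"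
      using conn unfolding k_connected_def by blast
    then obtain xs where "gpath ?E xs" "xs \<noteq> []" "set xs \<subseteq> pverts G - {m} \<inter> pverts G" "hd xs = x" "last xs = y"
      using connected_gpath[of G "pverts G - {m} \<inter> pverts G" x y] xy sym by blast
    then show "\<exists>xs. gpath ?E xs \<and> xs \<noteq> [] \<and> m \<notin> set xs \<and> hd xs = x \<and> last xs = y" by blast
  qed
qed

text \<open>
  A longest even cycle of length 6 among those of length at most 12 leaves no cycle of length 8, 10
  or 12, so the preceding sections apply: the hypotheses contradict each other.
\<close>

theorem theorem6p4:
  fixes G C :: "'a pair_pre_digraph" and R :: "'a set"
  assumes "pair_graph G"
    and "k_connected 2 G"
    and "card (pverts G) \<ge> 9"
    and "uniquely_cycle_saturated 9 G"
    and "longest_even_cycle_upto 12 G 6 C"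
    and "R = pverts G - pverts C"
  shows "\<forall>v \<in> R. \<exists>c \<in> pverts C. (v, c) \<in> parcs G"
proof -
  have "cycles_of G k = {}" if "k \<in> {8, 10, 12}" for k
    using that assms(5) unfolding longest_even_cycle_upto_def by fastforce
  then have "cycle9_saturated (pverts G) (\<lambda>x y. (x, y) \<in> parcs G)"
    using uniquely_cycle_saturated_imp_locale assms(1-4) by blast
  then show ?thesis using cycle9_saturated.inconsistent by blast
qed

end
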